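(* Let $(X,d)$ be a metric space, $Y$ a locally convex space, $K\subset Y$ a pointed convex cone specifying a partial order $\le_K$ on $Y$, and $H\subset K$ a nonempty $K$-convex set with $0\notin\mathrm{vcl}(H+K)$. Put $C_H:=H+K$. Let $f:X\to 2^Y$ be a set-valued map, $S$ a nonempty closed subset of $X$, $x_0\in S$, $\epsilon>0$, and let $\gamma>0$ be a constant. Suppose that the following conditions are satisfied: (i) $(X,d)$ is $(f,K)$-lower complete (or complete); (ii) $x_0\in AE(C_H,\epsilon)$; (iii'') $f$ is $K$-slm, $f(x)\subset Y$ is $\sigma(Y,K^+)$-sequentially compact for all $x\in X$, $H$ is $\sigma(Y,K^+)$-countably compact and $K$ is closed. Then there exists $\bar x\in S$ such that (a) $f(x_0)\subset f(\bar x)+\gamma\, d(x_0,\bar x)H+K$; (b) $f(\bar x)\not\subset f(x)+\gamma\, d(\bar x,x)H+K$ for all $x\in S\setminus\{\bar x\}$; (c) $d(x_0,\bar x)\le\epsilon/\gamma$.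
   Context: A locally convex space is a real locally convex Hausdorff topological vector space; $Y^*$ is its topological dual. $K^+=\{y^*\in Y^*: y^*(y)\ge 0\ \forall y\in K\}$, and $\sigma(Y,K^+)$ is the (not necessarily Hausdorff) locally convex topology on $Y$ generated by the seminorms $y\mapsto|y^*(y)|$, $y^*\in K^+$. A set is sequentially compact if every sequence in it has a subsequence converging to a point of the set, and countably compact if every sequence in it has a cluster point in the set (both with respect to the indicated topology). $2^Y$ is the family of all subsets of $Y$; for $A\subset X$, $f(A)=\bigcup_{x\in A}f(x)$. For $A,B\subset Y$ and $\alpha\in\mathbb R$, $A+B=\{a+b:a\in A,b\in B\}$ and $\alpha A=\{\alpha a:a\in A\}$. A cone is a nonempty set $K\subset Y$ with $\alpha K\subset K$ for all $\alpha\ge 0$; it is a convex cone if also $K+K\subset K$, and pointed if $K\cap(-K)=\{0\}$. Cones are always assumed nontrivial: $K\ne\{0\}$ and $K\ne Y$. The order is $y_1\le_K y_2\iff y_1-y_2\in -K$. A set $H$ is $K$-convex if $H+K$ is convex. For nonempty $A\subset Y$, the vector closure is $\mathrm{vcl}(A)=\{y\in Y:\exists v\in Y,\ \exists \lambda_n\ge 0,\ \lambda_n\to 0 \text{ with } y+\lambda_n v\in A\ \forall n\in\mathbb N\}$. $x_0\in AE(C_H,\epsilon)$ ($x_0$ is an $\epsilon$-efficient solution, in the sense of Németh with respect to $H$, of the problem of minimizing $f$ over $S$) means: $x_0\in S$ and there exists $y_0\in f(x_0)$ with $(f(S)-y_0)\cap(-\epsilon H-K)=\emptyset$. $f$ is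 $K$-slm ($K$-sequentially lower monotone) if for any sequence $(x_n)\subset X$ with $x_n\to\bar x\in X$ and $f(x_n)\subset f(x_{n+1})+K$ for all $n$, one has $f(x_n)\subset f(\bar x)+K$ for all $n$. $(X,d)$ is $(f,K)$-lower complete if every Cauchy sequence $(x_n)\subset X$ with $f(x_n)\subset f(x_{n+1})+K$ for all $n$ converges to some point of $X$. *)

theory Defs
  imports "HOL-Analysis.Analysis"
begin

text \<open>
  Real locally convex Hausdorff topological vector spaces. Convexity is unfolded here because
  the constant \<^const>\<open>convex\<close> is not available inside a class declaration;
  see \<open>locally_convex_nhd\<close> below.
\<close>

class locally_convex_space = real_vector + topological_ab_group_add + t2_space +
  assumes tendsto_scaleR_nhds:
    "((\<lambda>p. fst p *\<^sub>R snd p) \<longlongrightarrow> c *\<^sub>R x) (nhds c \<times>\<^sub>F nhds x)"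
  and locally_convex_0:
    "open U \<Longrightarrow> 0 \<in> U \<Longrightarrow> \<exists>V. open V \<and> 0 \<in> V \<and> V \<subseteq> U \<and>
      (\<forall>x\<in>V. \<forall>y\<in>V. \<forall>u\<ge>0. \<forall>v\<ge>0. u + v = 1 \<longrightarrow> u *\<^sub>R x + v *\<^sub>R y \<in> V)"

lemma locally_convex_nhd:
  fixes U :: "'y::locally_convex_space set"
  assumes "open U" "0 \<in> U"
  shows "\<exists>V. open V \<and> 0 \<in> V \<and> V \<subseteq> U \<and> convex V"
  unfolding convex_def using locally_convex_0[OF assms] .

instance real_normed_vector \<subseteq> locally_convex_space
proof
  fix c :: real and x :: 'a
  show "((\<lambda>p. fst p *\<^sub>R snd p) \<longlongrightarrow> c *\<^sub>R x) (nhds c \<times>\<^sub>F nhds x)"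
    by (intro tendsto_scaleR filterlim_fst filterlim_snd)
next
  fix U :: "'a set"
  assume "open U" "0 \<in> U"
  then obtain e where "e > 0" "ball 0 e \<subseteq> U"
    by (meson open_contains_ball)
  then show "\<exists>V. open V \<and> 0 \<in> V \<and> V \<subseteq> U \<and>
      (\<forall>x\<in>V. \<forall>y\<in>V. \<forall>u\<ge>0. \<forall>v\<ge>0. u + v = 1 \<longrightarrow> u *\<^sub>R x + v *\<^sub>R y \<in> V)"
    unfolding convex_def[symmetric] by (intro exI[of _ "ball 0 e"]) auto
qed

definition topological_dual :: "('y::locally_convex_space \<Rightarrow> real) set" where
  "topological_dual = {\<phi>. linear \<phi> \<and> continuous_on UNIV \<phi>}"

definition dual_cone :: "'y::locally_convex_space set \<Rightarrow> ('y \<Rightarrow> real) set" where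
  "dual_cone K = {\<phi> \<in> topological_dual. \<forall>y\<in>K. 0 \<le> \<phi> y}"

definition seminorm_topology :: "('y::real_vector \<Rightarrow> real) set \<Rightarrow> 'y topology" where
  "seminorm_topology P =
     topology_generated_by {{y. p (y - a) < r} | p a r. p \<in> P \<and> 0 < r}"

text \<open>
  The topology \<open>\<sigma>(Y, K\<^sup>+)\<close>. It need not be Hausdorff, which is why it is an explicit
  topology object. Its underlying space is all of \<open>Y\<close>, since \<open>0\<close> belongs to the dual cone.
\<close>

definition sigma_topology :: "'y::locally_convex_space set \<Rightarrow> 'y topology" where
  "sigma_topology K = seminorm_topology {\<lambda>y. \<bar>\<phi> y\<bar> | \<phi>. \<phi> \<in> dual_cone K}"

lemma topspace_sigma_topology: "topspace (sigma_topology (K :: 'y::locally_convex_space set)) = UNIV"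
proof -
  have "(\<lambda>y. 0) \<in> dual_cone K"
    by (auto simp: dual_cone_def topological_dual_def linear_iff)
  then have "\<exists>p. p \<in> {\<lambda>y. \<bar>\<phi> y\<bar> | \<phi>. \<phi> \<in> dual_cone K} \<and> p 0 = 0"
    by (intro exI[of _ "\<lambda>y. \<bar>(\<lambda>y. 0) y\<bar>"] conjI CollectI exI[of _ "\<lambda>y. 0"] refl) auto
  then obtain p where p: "p \<in> {\<lambda>y. \<bar>\<phi> y\<bar> | \<phi>. \<phi> \<in> dual_cone K}" "p 0 = 0"
    by (elim exE conjE)
  have "z \<in> topspace (sigma_topology K)" for z
    unfolding sigma_topology_def seminorm_topology_def topology_generated_by_topspace
  proof (rule UnionI)
    show "{y. p (y - z) < 1} \<in> {{y. p (y - a) < r} | p a r.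
        p \<in> {\<lambda>y. \<bar>\<phi> y\<bar> | \<phi>. \<phi> \<in> dual_cone K} \<and> 0 < r}"
      by (rule CollectI, intro exI[of _ p] exI[of _ z] exI[of _ 1] conjI refl p(1) zero_less_one)
    show "z \<in> {y. p (y - z) < 1}"
      using p(2) by simp
  qed
  then show ?thesis
    by (intro equalityI subset_UNIV subsetI)
qed

definition seq_compactin :: "'y topology \<Rightarrow> 'y set \<Rightarrow> bool" where
  "seq_compactin T A \<longleftrightarrow> A \<subseteq> topspace T \<and>
     (\<forall>s::nat \<Rightarrow> 'y. (\<forall>n. s n \<in> A) \<longrightarrow>
        (\<exists>l\<in>A. \<exists>r. strict_mono r \<and> limitin T (s \<circ> r) l sequentially))"

definition cluster_pointin :: "'y topology \<Rightarrow> (nat \<Rightarrow> 'y) \<Rightarrow> 'y \<Rightarrow> bool" where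
  "cluster_pointin T s l \<longleftrightarrow> l \<in> topspace T \<and>
     (\<forall>U. openin T U \<and> l \<in> U \<longrightarrow> (\<exists>\<^sub>F n in sequentially. s n \<in> U))"

definition countably_compactin :: "'y topology \<Rightarrow> 'y set \<Rightarrow> bool" where
  "countably_compactin T A \<longleftrightarrow> A \<subseteq> topspace T \<and>
     (\<forall>s::nat \<Rightarrow> 'y. (\<forall>n. s n \<in> A) \<longrightarrow> (\<exists>l\<in>A. cluster_pointin T s l))"

definition vcl :: "'y::real_vector set \<Rightarrow> 'y set" where
  "vcl A = {y. \<exists>v. \<exists>t::nat \<Rightarrow> real.
     (\<forall>n. 0 \<le> t n) \<and> t \<longlonglongrightarrow> 0 \<and> (\<forall>n. y + t n *\<^sub>R v \<in> A)}"

text \<open>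
  From here on, sums \<open>A + B\<close> of sets are the elementwise ones of \<^theory>\<open>HOL-Library.Set_Algebras\<close>.
  The negative of a set and the translate \<open>A - y\<close> are written as images, because the operator
  \<open>-\<close> on sets means complement and set difference.
\<close>

definition approx_efficient ::
    "('x \<Rightarrow> 'y::real_vector set) \<Rightarrow> 'x set \<Rightarrow> 'y set \<Rightarrow> 'y set \<Rightarrow> real \<Rightarrow> 'x set" where
  "approx_efficient f S K H \<epsilon> = {x\<^sub>0 \<in> S. \<exists>y\<^sub>0\<in>f x\<^sub>0.
     (\<lambda>y. y - y\<^sub>0) ` (\<Union>x\<in>S. f x) \<inter> (scaleR (- \<epsilon>) ` H + uminus ` K) = {}}"

definition seq_lower_monotone ::
    "('x::topological_space \<Rightarrow> 'y::real_vector set) \<Rightarrow> 'y set \<Rightarrow> bool" where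
  "seq_lower_monotone f K \<longleftrightarrow>
     (\<forall>(xs::nat \<Rightarrow> 'x) xb. xs \<longlonglongrightarrow> xb \<and> (\<forall>n. f (xs n) \<subseteq> f (xs (Suc n)) + K)
        \<longrightarrow> (\<forall>n. f (xs n) \<subseteq> f xb + K))"

definition lower_complete ::
    "('x::metric_space \<Rightarrow> 'y::real_vector set) \<Rightarrow> 'y set \<Rightarrow> bool" where
  "lower_complete f K \<longleftrightarrow>
     (\<forall>xs::nat \<Rightarrow> 'x. Cauchy xs \<and> (\<forall>n. f (xs n) \<subseteq> f (xs (Suc n)) + K)
        \<longrightarrow> (\<exists>xb. xs \<longlonglongrightarrow> xb))"

end

theory Submission
  imports Defs
begin

text \<open>
  Write \<open>x \<preceq> z\<close> for \<open>f x \<subseteq> f z + \<gamma> d(x,z) H + K\<close>. This relation is reflexive, and because \<open>H + K\<close>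
  is convex, \<open>aH + bH + K \<subseteq> (a + b)H + K\<close>, so the triangle inequality makes it transitive
  (\<open>scaled_subset_trans\<close>). Conclusions (a) and (b) say that \<open>xb\<close> is a maximal element of \<open>S\<close>
  above \<open>x\<^sub>0\<close>.

  Such an element is found by a greedy chain \<open>x\<^sub>0 \<preceq> x\<^sub>1 \<preceq> \<dots>\<close>, each step of which is at least half as
  long as possible, distances above \<open>1\<close> being counted as \<open>1\<close> (\<open>exists_maximal_if_chains_converge\<close>).
  What has to be shown is that every chain in \<open>S\<close> from \<open>x\<^sub>0\<close> converges to an upper bound of itself.

  Adding up the steps gives \<open>f x\<^sub>0 \<subseteq> f x\<^sub>n + \<gamma> L H + K\<close>, where \<open>L\<close> is the length of the chain up to
  \<open>x\<^sub>n\<close>, and \<open>\<epsilon>\<close>-efficiency forbids \<open>\<gamma> L \<ge> \<epsilon>\<close> (\<open>approx_efficient_descent_less\<close>). So chains have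
  bounded length, hence are Cauchy and converge to some \<open>x \<in> S\<close>. The same estimate applied to the
  single step from \<open>x\<^sub>0\<close> to \<open>xb\<close> gives (c).

  That the limit \<open>x\<close> is an upper bound is the place where compactness enters. Monotonicity of \<open>f\<close>
  gives \<open>f x\<^sub>n \<subseteq> f x + \<gamma> d(x\<^sub>n,x\<^sub>m) H + K\<close> for all \<open>m \<ge> n\<close>, and one lets \<open>m\<close> tend to infinity
  (\<open>mem_compact_plus_scaled_cone_limit\<close>). The compactness hypotheses supply limits only when tested
  against functionals of the dual cone, but this is enough: by the bipolar theorem
  (\<open>mem_closed_cone_if_dual_cone_nonneg\<close>) these functionals determine a closed convex cone. The
  bipolar theorem is in turn a case of the Hahn-Banach theorem, applied to the gauge of a
  neighbourhood of the cone.
\<close>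

section \<open>Sublinear functionals and the Hahn-Banach theorem\<close>

text \<open>
  Homogeneity is required only as an inequality, which leaves less to check for infima of
  functionals; the reverse inequality follows by scaling with \<open>1/c\<close>.
\<close>

definition sublinear :: "('a::real_vector \<Rightarrow> real) \<Rightarrow> bool" where
  "sublinear p \<longleftrightarrow> (\<forall>x y. p (x + y) \<le> p x + p y) \<and> (\<forall>c>0. \<forall>x. p (c *\<^sub>R x) \<le> c * p x)"

lemma sublinear_scaleR:
  assumes "sublinear p" "c > 0"
  shows "p (c *\<^sub>R x) = c * p x"
proof (rule antisym)
  show "p (c *\<^sub>R x) \<le> c * p x"
    using assms by (auto simp: sublinear_def)
  have "p ((1/c) *\<^sub>R (c *\<^sub>R x)) \<le> (1/c) * p (c *\<^sub>R x)"
    using assms unfolding sublinear_def by (metis zero_less_divide_1_iff)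
  then show "c * p x \<le> p (c *\<^sub>R x)"
    using assms by (simp add: field_simps)
qed

lemma sublinear_0:
  assumes "sublinear p"
  shows "p 0 = 0"
  using sublinear_scaleR[OF assms, of 2 0] by simp

lemma sublinear_minus_le:
  assumes "sublinear p"
  shows "- p (- x) \<le> p x"
proof -
  have "p (x + - x) \<le> p x + p (- x)"
    using assms unfolding sublinear_def by blast
  then show ?thesis
    using sublinear_0[OF assms] by simp
qed

text \<open>
  The infimal convolution of \<open>p\<close> with the functional that is \<open>- t p(a)\<close> at \<open>- t a\<close> for \<open>t \<ge> 0\<close>
  and infinite elsewhere. It is the largest sublinear functional below \<open>p\<close> whose value at \<open>- a\<close> is
  at most \<open>- p(a)\<close>, so a linear functional below it has to agree with \<open>p\<close> at \<open>a\<close>.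
\<close>

definition tilt :: "('a::real_vector \<Rightarrow> real) \<Rightarrow> 'a \<Rightarrow> 'a \<Rightarrow> real" where
  "tilt p a x = (INF t\<in>{0..}. p (x + t *\<^sub>R a) - t * p a)"

lemma tilt_le:
  assumes "sublinear p" "t \<ge> 0"
  shows "tilt p a x \<le> p (x + t *\<^sub>R a) - t * p a"
proof -
  have "- p (- x) \<le> p (x + s *\<^sub>R a) - s * p a" if "s \<ge> 0" for s
  proof (cases "s = 0")
    case True
    then show ?thesis
      using sublinear_minus_le[OF assms(1)] by simp
  next
    case False
    have "p ((x + s *\<^sub>R a) + - x) \<le> p (x + s *\<^sub>R a) + p (- x)"
      using assms(1) unfolding sublinear_def by blast
    then show ?thesis
      using sublinear_scaleR[OF assms(1), of s a] that False by simp
  qed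
  then show ?thesis
    unfolding tilt_def using assms(2) by (intro cINF_lower bdd_belowI2) auto
qed

lemma tilt_le_self:
  assumes "sublinear p"
  shows "tilt p a \<le> p"
  using tilt_le[OF assms, of 0 a] by (simp add: le_fun_def)

lemma tilt_uminus_le:
  assumes "sublinear p"
  shows "tilt p a (- a) \<le> - p a"
  using tilt_le[OF assms, of 1 a "- a"] sublinear_0[OF assms] by simp

lemma sublinear_tilt:
  assumes "sublinear p"
  shows "sublinear (tilt p a)"
  unfolding sublinear_def
proof (intro conjI allI impI)
  fix x y
  have *: "tilt p a (x + y) \<le> (p (x + s *\<^sub>R a) - s * p a) + (p (y + t *\<^sub>R a) - t * p a)"
    if "s \<ge> 0" "t \<ge> 0" for s t
  proof -
    have "p ((x + s *\<^sub>R a) + (y + t *\<^sub>R a)) \<le> p (x + s *\<^sub>R a) + p (y + t *\<^sub>R a)"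
      using assms unfolding sublinear_def by blast
    moreover have "(x + s *\<^sub>R a) + (y + t *\<^sub>R a) = (x + y) + (s + t) *\<^sub>R a"
      by (simp add: algebra_simps)
    ultimately show ?thesis
      using tilt_le[OF assms, of "s + t" a "x + y"] that by (simp add: algebra_simps)
  qed
  have "tilt p a (x + y) - tilt p a x \<le> p (y + t *\<^sub>R a) - t * p a" if "t \<ge> 0" for t
  proof -
    have "tilt p a (x + y) - (p (y + t *\<^sub>R a) - t * p a) \<le> tilt p a x"
      unfolding tilt_def[of p a x] using *[OF _ that] by (intro cINF_greatest) (auto simp: algebra_simps)
    then show ?thesis by simp
  qed
  then have "tilt p a (x + y) - tilt p a x \<le> tilt p a y"
    unfolding tilt_def[of p a y] by (intro cINF_greatest) auto
  then show "tilt p a (x + y) \<le> tilt p a x + tilt p a y"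
    by simp
next
  fix c :: real and x assume c: "c > 0"
  have "tilt p a (c *\<^sub>R x) / c \<le> p (x + t *\<^sub>R a) - t * p a" if "t \<ge> 0" for t
  proof -
    have "tilt p a (c *\<^sub>R x) \<le> p (c *\<^sub>R x + (c * t) *\<^sub>R a) - c * t * p a"
      using tilt_le[OF assms, of "c * t"] c that by simp
    also have "c *\<^sub>R x + (c * t) *\<^sub>R a = c *\<^sub>R (x + t *\<^sub>R a)"
      by (simp add: scaleR_add_right)
    also have "p (c *\<^sub>R (x + t *\<^sub>R a)) = c * p (x + t *\<^sub>R a)"
      by (rule sublinear_scaleR[OF assms c])
    finally show ?thesis
      using c by (simp add: field_simps)
  qed
  then have "tilt p a (c *\<^sub>R x) / c \<le> tilt p a x"
    unfolding tilt_def[of p a x] by (intro cINF_greatest) auto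
  then show "tilt p a (c *\<^sub>R x) \<le> c * tilt p a x"
    using c by (simp add: field_simps)
qed

text \<open>
  Tilting a minimal \<open>q\<close> towards any \<open>a\<close> must leave it unchanged, which forces \<open>q(- a) = - q(a)\<close>;
  a sublinear functional that is odd is linear.
\<close>

lemma linear_if_minimal_sublinear:
  assumes q: "sublinear q"
    and minimal: "\<And>r. sublinear r \<Longrightarrow> r \<le> q \<Longrightarrow> r = q"
  shows "linear q"
proof -
  have neg: "q (- a) = - q a" for a
    using tilt_uminus_le[OF q, of a] sublinear_minus_le[OF q, of a]
      minimal[OF sublinear_tilt[OF q] tilt_le_self[OF q], of a] by simp
  have sub: "q (x + y) \<le> q x + q y" for x y
    using q unfolding sublinear_def by blast
  have add: "q (x + y) = q x + q y" for x y
    using sub[of x y] sub[of "x + y" "- y"] neg[of y] by simp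
  have scale: "q (c *\<^sub>R x) = c * q x" for c x
  proof (cases c "0::real" rule: linorder_cases)
    case less
    then show ?thesis
      using sublinear_scaleR[OF q, of "- c" x] neg[of "c *\<^sub>R x"] by simp
  qed (use sublinear_0[OF q] sublinear_scaleR[OF q] in auto)
  show ?thesis
    by (rule linearI) (simp_all add: add scale)
qed

text \<open>
  The bound \<open>- p(- x) \<le> - q(- x) \<le> q(x)\<close> keeps the pointwise infimum finite. It is subadditive
  because any two members of the chain have a common lower bound inside the chain.
\<close>

lemma sublinear_INF_chain:
  fixes C :: "('a::real_vector \<Rightarrow> real) set"
  assumes "C \<noteq> {}" and C: "\<And>q. q \<in> C \<Longrightarrow> sublinear q \<and> q \<le> p"
    and chain: "\<And>q r. q \<in> C \<Longrightarrow> r \<in> C \<Longrightarrow> q \<le> r \<or> r \<le> q"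
  defines "m \<equiv> \<lambda>x. INF q\<in>C. q x"
  shows "sublinear m" "\<And>q. q \<in> C \<Longrightarrow> m \<le> q"
proof -
  have low: "m x \<le> q x" if "q \<in> C" for q x
  proof -
    have "- p (- x) \<le> r x" if "r \<in> C" for r
      using C[OF that] sublinear_minus_le[of r x] by (force dest: le_funD[of r p "- x"])
    then show ?thesis
      unfolding m_def using that by (intro cINF_lower bdd_belowI2) auto
  qed
  then show "\<And>q. q \<in> C \<Longrightarrow> m \<le> q"
    by (simp add: le_fun_def)
  show "sublinear m"
    unfolding sublinear_def
  proof (intro conjI allI impI)
    fix x y
    have *: "m (x + y) \<le> q x + r y" if qr: "q \<in> C" "r \<in> C" for q r
    proof -
      obtain s where s: "s \<in> C" "s \<le> q" "s \<le> r"
        using chain[OF qr] qr by blast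
      have "m (x + y) \<le> s (x + y)"
        by (rule low[OF s(1)])
      also have "\<dots> \<le> s x + s y"
        using C[OF s(1)] unfolding sublinear_def by blast
      also have "\<dots> \<le> q x + r y"
        using s by (intro add_mono) (auto simp: le_fun_def)
      finally show ?thesis .
    qed
    have "m (x + y) - m x \<le> r y" if "r \<in> C" for r
    proof -
      have "m (x + y) - r y \<le> (INF q\<in>C. q x)"
        using *[OF _ that] assms(1) by (intro cINF_greatest) (auto simp: algebra_simps)
      then show ?thesis by (simp add: m_def)
    qed
    then have "m (x + y) - m x \<le> (INF q\<in>C. q y)"
      using assms(1) by (intro cINF_greatest)
    then show "m (x + y) \<le> m x + m y"
      by (simp add: m_def)
  next
    fix c :: real and x assume c: "c > 0"
    have "m (c *\<^sub>R x) / c \<le> q x" if "q \<in> C" for q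
      using low[OF that, of "c *\<^sub>R x"] C[OF that] sublinear_scaleR[of q c x] c
      by (simp add: field_simps)
    then have "m (c *\<^sub>R x) / c \<le> (INF q\<in>C. q x)"
      using assms(1) by (intro cINF_greatest)
    then show "m (c *\<^sub>R x) \<le> c * m x"
      using c by (simp add: m_def field_simps)
  qed
qed

lemma linear_below_sublinear:
  assumes p: "sublinear p"
  shows "\<exists>\<phi>. linear \<phi> \<and> \<phi> \<le> p"
proof -
  let ?A = "{q. sublinear q \<and> q \<le> p}"
  let ?P = "\<lambda>q r. r \<le> q"
  have "\<exists>m\<in>?A. \<forall>a\<in>?A. ?P m a \<longrightarrow> a = m"
  proof (rule predicate_Zorn)
    show "partial_order_on ?A (relation_of ?P ?A)"
      by (rule partial_order_on_relation_ofI) auto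
  next
    fix C assume "C \<in> Chains (relation_of ?P ?A)"
    then have C: "\<And>q. q \<in> C \<Longrightarrow> sublinear q \<and> q \<le> p"
      "\<And>q r. q \<in> C \<Longrightarrow> r \<in> C \<Longrightarrow> q \<le> r \<or> r \<le> q"
      unfolding Chains_def relation_of_def by auto
    show "\<exists>u\<in>?A. \<forall>a\<in>C. ?P a u"
    proof (cases "C = {}")
      case True
      then show ?thesis using p by auto
    next
      case False
      note m = sublinear_INF_chain[OF False C]
      obtain q where "q \<in> C" using False by blast
      then have "(\<lambda>x. INF q\<in>C. q x) \<le> p"
        using m(2) C(1) order_trans by blast
      then show ?thesis
        using m by (intro bexI[of _ "\<lambda>x. INF q\<in>C. q x"]) auto
    qed
  qed
  then obtain m where m: "sublinear m" "m \<le> p"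
      "\<And>r. sublinear r \<Longrightarrow> r \<le> p \<Longrightarrow> r \<le> m \<Longrightarrow> r = m"
    by auto
  have "linear m"
    using m by (intro linear_if_minimal_sublinear) (auto intro: order_trans)
  then show ?thesis
    using m(2) by blast
qed

text \<open>
  Prescribing the value at one point replaces the usual extension from a subspace: tilting \<open>p\<close>
  towards \<open>a\<close> first makes every linear functional below the result attain \<open>p(a)\<close> at \<open>a\<close>.
\<close>

theorem Hahn_Banach_sublinear:
  assumes p: "sublinear p"
  shows "\<exists>\<phi>. linear \<phi> \<and> \<phi> \<le> p \<and> \<phi> a = p a"
proof -
  obtain \<phi> where \<phi>: "linear \<phi>" "\<phi> \<le> tilt p a"
    using linear_below_sublinear[OF sublinear_tilt[OF p]] by blast
  have le: "\<phi> \<le> p"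
    using \<phi>(2) tilt_le_self[OF p] by (rule order_trans)
  have "\<phi> (- a) \<le> - p a"
    using le_funD[OF \<phi>(2)] tilt_uminus_le[OF p] by (rule order_trans)
  then have "\<phi> a = p a"
    using le_funD[OF le, of a] linear_neg[OF \<phi>(1), of a] by simp
  then show ?thesis
    using \<phi>(1) le by blast
qed

section \<open>Separation of convex sets and closed cones\<close>

definition gauge_functional :: "'a::real_vector set \<Rightarrow> 'a \<Rightarrow> real" where
  "gauge_functional W x = Inf {t. t > 0 \<and> x \<in> scaleR t ` W}"

lemma gauge_functional_le:
  assumes "t > 0" "x \<in> scaleR t ` W"
  shows "gauge_functional W x \<le> t"
  unfolding gauge_functional_def using assms
  by (intro cInf_lower bdd_belowI[of _ 0]) auto

lemma sublinear_gauge_functional: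
  assumes W: "convex W" and absorbing: "\<And>x. \<exists>t>0. x \<in> scaleR t ` W"
  shows "sublinear (gauge_functional W)"
proof -
  have approx: "\<exists>t>0. t < r \<and> x \<in> scaleR t ` W" if "gauge_functional W x < r" for x r
  proof -
    have ne: "{t. t > 0 \<and> x \<in> scaleR t ` W} \<noteq> {}"
      using absorbing[of x] by auto
    show ?thesis
      using cInf_lessD[OF ne, of r] that unfolding gauge_functional_def by blast
  qed
  show ?thesis
    unfolding sublinear_def
  proof (intro conjI allI impI)
    fix x y
    show "gauge_functional W (x + y) \<le> gauge_functional W x + gauge_functional W y"
    proof (rule field_le_epsilon)
      fix e :: real assume "e > 0"
      obtain s where s: "s > 0" "s < gauge_functional W x + e/2" "x \<in> scaleR s ` W"
        using approx[of x "gauge_functional W x + e/2"] \<open>e > 0\<close> by auto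
      obtain t where t: "t > 0" "t < gauge_functional W y + e/2" "y \<in> scaleR t ` W"
        using approx[of y "gauge_functional W y + e/2"] \<open>e > 0\<close> by auto
      obtain u v where uv: "u \<in> W" "x = s *\<^sub>R u" "v \<in> W" "y = t *\<^sub>R v"
        using s t by auto
      have "(s / (s + t)) *\<^sub>R u + (t / (s + t)) *\<^sub>R v \<in> W"
        using s t uv by (intro convexD[OF W]) (auto simp: add_divide_distrib[symmetric])
      moreover have "x + y = (s + t) *\<^sub>R ((s / (s + t)) *\<^sub>R u + (t / (s + t)) *\<^sub>R v)"
        using s t uv by (simp add: scaleR_add_right)
      ultimately have "gauge_functional W (x + y) \<le> s + t"
        using s t by (intro gauge_functional_le) auto
      then show "gauge_functional W (x + y) \<le> gauge_functional W x + gauge_functional W y + e"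
        using s t by simp
    qed
  next
    fix c :: real and x assume c: "c > 0"
    show "gauge_functional W (c *\<^sub>R x) \<le> c * gauge_functional W x"
    proof (rule field_le_epsilon)
      fix e :: real assume "e > 0"
      then obtain s where s: "s > 0" "s < gauge_functional W x + e/c" "x \<in> scaleR s ` W"
        using approx[of x "gauge_functional W x + e/c"] c by auto
      then have "gauge_functional W (c *\<^sub>R x) \<le> c * s"
        using c by (intro gauge_functional_le) auto
      also have "\<dots> \<le> c * gauge_functional W x + e"
        using s(2) c by (simp add: field_simps)
      finally show "gauge_functional W (c *\<^sub>R x) \<le> c * gauge_functional W x + e" .
    qed
  qed
qed

text \<open>
  The gauge of \<open>W\<close> is at most \<open>1\<close> on \<open>W\<close> and at least \<open>1\<close> off \<open>W\<close>; a linear functional below the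
  gauge that touches it at \<open>a\<close> separates.
\<close>

lemma absorbing_convex_separation:
  assumes W: "convex W" and absorbing: "\<And>x. \<exists>t>0. x \<in> scaleR t ` W" and "a \<notin> W"
  shows "\<exists>\<phi> :: 'a::real_vector \<Rightarrow> real. linear \<phi> \<and> (\<forall>x\<in>W. \<phi> x \<le> 1) \<and> 1 \<le> \<phi> a"
proof -
  obtain \<phi> where \<phi>: "linear \<phi>" "\<phi> \<le> gauge_functional W" "\<phi> a = gauge_functional W a"
    using Hahn_Banach_sublinear[OF sublinear_gauge_functional[OF W absorbing]] by blast
  have "0 \<in> W"
    using absorbing[of 0] by auto
  have "1 \<le> t" if "t > 0" "a \<in> scaleR t ` W" for t
  proof (rule ccontr)
    assume t: "\<not> 1 \<le> t"
    obtain w where w: "w \<in> W" "a = t *\<^sub>R w"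
      using \<open>a \<in> scaleR t ` W\<close> by blast
    have "t *\<^sub>R w + (1 - t) *\<^sub>R 0 \<in> W"
      using w t that \<open>0 \<in> W\<close> by (intro convexD[OF W]) auto
    then show False
      using w \<open>a \<notin> W\<close> by simp
  qed
  moreover have "{t. t > 0 \<and> a \<in> scaleR t ` W} \<noteq> {}"
    using absorbing[of a] by auto
  ultimately have "1 \<le> \<phi> a"
    unfolding \<phi>(3) gauge_functional_def by (intro cInf_greatest) auto
  moreover have "\<phi> x \<le> 1" if "x \<in> W" for x
    using le_funD[OF \<phi>(2), of x] gauge_functional_le[of 1 x W] that by simp
  ultimately show ?thesis
    using \<phi>(1) by blast
qed

lemma continuous_on_scaleR_const:
  "continuous_on UNIV (\<lambda>x::'y::locally_convex_space. c *\<^sub>R x)"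
proof -
  have "((\<lambda>x. c *\<^sub>R x) \<longlongrightarrow> c *\<^sub>R a) (nhds a)" for a :: 'y
  proof -
    have "LIM x nhds a. (c, x) :> nhds c \<times>\<^sub>F nhds a"
      by (intro filterlim_Pair tendsto_const filterlim_ident)
    from filterlim_compose[OF tendsto_scaleR_nhds this] show ?thesis by simp
  qed
  then show ?thesis
    by (auto simp: continuous_on_def tendsto_nhds_iff intro: tendsto_within_subset)
qed

lemma open_nhd_absorbing:
  fixes V :: "'y::locally_convex_space set"
  assumes "open V" "0 \<in> V"
  shows "\<exists>t>0. x \<in> scaleR t ` V"
proof -
  have "LIM c nhds (0::real). (c, x) :> nhds 0 \<times>\<^sub>F nhds x"
    by (intro filterlim_Pair filterlim_ident) (rule tendsto_const)
  from filterlim_compose[OF tendsto_scaleR_nhds this]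
  have "((\<lambda>c. c *\<^sub>R x) \<longlongrightarrow> 0) (nhds (0::real))" by simp
  then have "((\<lambda>c. c *\<^sub>R x) \<longlongrightarrow> 0) (at_right (0::real))"
    by (rule filterlim_mono) (auto simp: at_within_le_nhds)
  then have "\<forall>\<^sub>F c in at_right (0::real). c *\<^sub>R x \<in> V"
    using assms by (auto dest: topological_tendstoD)
  then have "\<forall>\<^sub>F c in at_right (0::real). c > 0 \<and> c *\<^sub>R x \<in> V"
    using eventually_at_right_less[of "0::real"] by eventually_elim auto
  then obtain c :: real where "c > 0" "c *\<^sub>R x \<in> V"
    using eventually_happens'[OF trivial_limit_at_right_real] by blast
  then show ?thesis
    by (intro exI[of _ "1/c"]) (auto intro!: image_eqI[of _ _ "c *\<^sub>R x"])
qed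

text \<open>
  A one-sided bound suffices: where both \<open>(2/e)(x - a)\<close> and its negative lie in \<open>V\<close>, it bounds
  \<open>\<phi>(x) - \<phi>(a)\<close> by \<open>e/2\<close> on both sides.
\<close>

lemma continuous_linear_if_bounded_on_nhd:
  fixes \<phi> :: "'y::locally_convex_space \<Rightarrow> real"
  assumes \<phi>: "linear \<phi>" and V: "open V" "0 \<in> V" and le: "\<And>v. v \<in> V \<Longrightarrow> \<phi> v \<le> 1"
  shows "continuous_on UNIV \<phi>"
proof -
  have "\<forall>\<^sub>F x in nhds a. dist (\<phi> x) (\<phi> a) < e" if "e > 0" for a e
  proof -
    have nhd: "\<forall>\<^sub>F x in nhds a. (c *\<^sub>R (x - a)) \<in> V" for c
    proof (rule topological_tendstoD[OF _ V(1)])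
      have "isCont (\<lambda>y. c *\<^sub>R y) (0::'y)"
        using continuous_on_scaleR_const[where c = c and 'y = 'y] by (simp add: continuous_on_eq_continuous_at)
      moreover have "((\<lambda>x. x + - a) \<longlongrightarrow> a + - a) (nhds a)"
        by (intro tendsto_add filterlim_ident tendsto_const)
      ultimately show "((\<lambda>x. c *\<^sub>R (x - a)) \<longlongrightarrow> 0) (nhds a)"
        using isCont_tendsto_compose[of 0 "\<lambda>y. c *\<^sub>R y" "\<lambda>x. x - a"] by simp
    qed (use V in simp)
    have "\<forall>\<^sub>F x in nhds a. (2/e) *\<^sub>R (x - a) \<in> V \<and> (- (2/e)) *\<^sub>R (x - a) \<in> V"
      by (intro eventually_conj nhd)
    then show ?thesis
    proof eventually_elim
      case (elim x)
      have "(2/e) * (\<phi> x - \<phi> a) \<le> 1" "- (2/e) * (\<phi> x - \<phi> a) \<le> 1"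
        using elim le[of "(2/e) *\<^sub>R (x - a)"] le[of "(- (2/e)) *\<^sub>R (x - a)"]
        unfolding linear_cmul[OF \<phi>] linear_diff[OF \<phi>] by auto
      then show ?case
        using that by (auto simp: dist_real_def field_simps abs_less_iff)
    qed
  qed
  then have "(\<phi> \<longlongrightarrow> \<phi> a) (nhds a)" for a
    by (intro tendstoI) auto
  then show ?thesis
    by (auto simp: continuous_on_def tendsto_nhds_iff intro: tendsto_within_subset)
qed

lemma zero_mem_cone: "cone K \<Longrightarrow> K \<noteq> {} \<Longrightarrow> 0 \<in> K" for K :: "'a::real_vector set"
  unfolding cone_def by (metis all_not_in_conv order_refl scaleR_zero_left)

text \<open>
  One half of the bipolar theorem. If \<open>w \<notin> K\<close>, some convex neighbourhood \<open>V\<close> of \<open>0\<close> satisfies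
  \<open>w \<notin> K - V\<close>. The set \<open>K - V\<close> is convex and absorbing, and a functional bounded above on it is
  nonpositive on the cone \<open>K\<close> and continuous, since it is bounded on one side on \<open>V\<close>; its negative
  lies in the dual cone and is negative at \<open>w\<close>.
\<close>

theorem mem_closed_cone_if_dual_cone_nonneg:
  fixes K :: "'y::locally_convex_space set"
  assumes K: "closed K" "K \<noteq> {}" "cone K" "K + K \<subseteq> K"
    and nonneg: "\<And>\<phi>. \<phi> \<in> dual_cone K \<Longrightarrow> 0 \<le> \<phi> w"
  shows "w \<in> K"
proof (rule ccontr)
  assume w: "w \<notin> K"
  have "open ((\<lambda>v. w + v) -` (- K))"
    using K(1) by (intro open_vimage continuous_intros) auto
  moreover have "0 \<in> (\<lambda>v. w + v) -` (- K)"
    using w by simp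
  ultimately obtain V where V: "open V" "0 \<in> V" "convex V" "V \<subseteq> (\<lambda>v. w + v) -` (- K)"
    using locally_convex_nhd by metis
  have "0 \<in> K"
    using K by (intro zero_mem_cone)
  define W where "W = {k + - v | k v. k \<in> K \<and> v \<in> V}"
  have convK: "convex K"
  proof (rule convexI)
    fix x y :: 'y and u v :: real
    assume "x \<in> K" "y \<in> K" "0 \<le> u" "0 \<le> v"
    then have "u *\<^sub>R x \<in> K" "v *\<^sub>R y \<in> K"
      using K(3) by (auto simp: cone_def)
    then show "u *\<^sub>R x + v *\<^sub>R y \<in> K"
      using K(4) set_plus_intro by blast
  qed
  have "W = K + uminus ` V"
    by (auto simp: W_def set_plus_def)
  then have "convex W"
    using convK V(3) by (simp add: convex_set_plus convex_negations)
  moreover have "\<exists>t>0. x \<in> scaleR t ` W" for x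
  proof -
    obtain t v where "t > 0" "v \<in> V" "- x = t *\<^sub>R v"
      using open_nhd_absorbing[OF V(1,2), of "- x"] by auto
    moreover have "0 + - v \<in> W"
      unfolding W_def using \<open>0 \<in> K\<close> \<open>v \<in> V\<close> by blast
    moreover have "x = t *\<^sub>R (0 + - v)"
      using \<open>- x = t *\<^sub>R v\<close> by (metis add_0 minus_minus scaleR_minus_right)
    ultimately show ?thesis by blast
  qed
  moreover have "w \<notin> W"
  proof
    assume "w \<in> W"
    then obtain k v where "k \<in> K" "v \<in> V" "w = k + - v"
      by (auto simp: W_def)
    then have "w + v \<in> K" by simp
    then show False
      using V(4) \<open>v \<in> V\<close> by auto
  qed
  ultimately have "\<exists>\<phi> :: 'y \<Rightarrow> real. linear \<phi> \<and> (\<forall>x\<in>W. \<phi> x \<le> 1) \<and> 1 \<le> \<phi> w"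
    by (rule absorbing_convex_separation)
  then obtain \<psi> :: "'y \<Rightarrow> real"
    where \<psi>: "linear \<psi>" "\<And>x. x \<in> W \<Longrightarrow> \<psi> x \<le> 1" "1 \<le> \<psi> w"
    by blast
  have "\<psi> k \<le> 0" if "k \<in> K" for k
  proof (rule ccontr)
    assume pos: "\<not> \<psi> k \<le> 0"
    have "(2 / \<psi> k) *\<^sub>R k \<in> K"
      using K(3) that pos by (simp add: cone_def)
    then have "(2 / \<psi> k) *\<^sub>R k + - 0 \<in> W"
      unfolding W_def using V(2) by blast
    then have "\<psi> ((2 / \<psi> k) *\<^sub>R k) \<le> 1"
      using \<psi>(2) by simp
    then show False
      using pos by (simp add: linear_cmul[OF \<psi>(1)])
  qed
  moreover have lin: "linear (\<lambda>x. - \<psi> x)"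
    using \<psi>(1) by (simp add: linear_iff)
  moreover have "continuous_on UNIV (\<lambda>x. - \<psi> x)"
  proof (rule continuous_linear_if_bounded_on_nhd[OF lin V(1,2)])
    fix v assume "v \<in> V"
    then have "0 + - v \<in> W"
      unfolding W_def using \<open>0 \<in> K\<close> by blast
    then show "- \<psi> v \<le> 1"
      using \<psi>(2)[of "- v"] linear_neg[OF \<psi>(1)] by simp
  qed
  ultimately have "(\<lambda>x. - \<psi> x) \<in> dual_cone K"
    by (auto simp: dual_cone_def topological_dual_def)
  then show False
    using nonneg \<psi>(3) by force
qed

section \<open>Convergence against functionals of the dual cone\<close>

lemma openin_sigma_topology_basic:
  assumes "\<phi> \<in> dual_cone K" "r > 0"
  shows "openin (sigma_topology K) {y. \<bar>\<phi> (y - a)\<bar> < r}"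
  unfolding sigma_topology_def seminorm_topology_def
proof (rule topology_generated_by_Basis, rule CollectI)
  show "\<exists>p b s. {y. \<bar>\<phi> (y - a)\<bar> < r} = {y. p (y - b) < s} \<and>
      p \<in> {\<lambda>y. \<bar>\<psi> y\<bar> | \<psi>. \<psi> \<in> dual_cone K} \<and> 0 < s"
    using assms by (intro exI[of _ "\<lambda>y. \<bar>\<phi> y\<bar>"] exI[of _ a] exI[of _ r]) auto
qed

lemma linear_dual_cone: "\<phi> \<in> dual_cone K \<Longrightarrow> linear \<phi>"
  by (simp add: dual_cone_def topological_dual_def)

lemma tendsto_dual_cone_if_limitin_sigma:
  assumes "limitin (sigma_topology K) s l sequentially" and \<phi>: "\<phi> \<in> dual_cone K"
  shows "(\<lambda>n. \<phi> (s n)) \<longlonglongrightarrow> \<phi> l"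
proof (rule tendstoI)
  fix e :: real assume "e > 0"
  have "l \<in> {y. \<bar>\<phi> (y - l)\<bar> < e}"
    using \<open>e > 0\<close> linear_0[OF linear_dual_cone[OF \<phi>]] by simp
  then have "\<forall>\<^sub>F n in sequentially. s n \<in> {y. \<bar>\<phi> (y - l)\<bar> < e}"
    using assms(1) openin_sigma_topology_basic[OF \<phi> \<open>e > 0\<close>, of l]
    unfolding limitin_def by blast
  then show "\<forall>\<^sub>F n in sequentially. dist (\<phi> (s n)) (\<phi> l) < e"
    by (simp add: dist_real_def linear_diff[OF linear_dual_cone[OF \<phi>]])
qed

lemma frequently_dual_cone_if_cluster_pointin_sigma:
  assumes "cluster_pointin (sigma_topology K) s l" and \<phi>: "\<phi> \<in> dual_cone K" and "e > 0"
  shows "\<exists>\<^sub>F n in sequentially. \<bar>\<phi> (s n) - \<phi> l\<bar> < e"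
proof -
  have "l \<in> {y. \<bar>\<phi> (y - l)\<bar> < e}"
    using \<open>e > 0\<close> linear_0[OF linear_dual_cone[OF \<phi>]] by simp
  then have "\<exists>\<^sub>F n in sequentially. s n \<in> {y. \<bar>\<phi> (y - l)\<bar> < e}"
    using assms(1) openin_sigma_topology_basic[OF \<phi> \<open>e > 0\<close>, of l]
    unfolding cluster_pointin_def by blast
  then show ?thesis
    by (simp add: linear_diff[OF linear_dual_cone[OF \<phi>]])
qed

text \<open>
  Write \<open>y = z n + c n *\<^sub>R h n + k n\<close> and pass to a subsequence along which \<open>z\<close> converges to \<open>z0\<close>,
  and to a cluster point \<open>h0\<close> of \<open>h\<close> along it. Every functional of the dual cone is nonnegative
  at \<open>k n\<close>, hence also at \<open>y - z0 - c0 *\<^sub>R h0\<close>, which therefore lies in \<open>K\<close>. Countable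
  compactness does not give one subsequence of \<open>h\<close> that works for all functionals at once, but as
  the functionals are tested one at a time, a cluster point is enough.
\<close>

lemma mem_compact_plus_scaled_cone_limit:
  fixes K A H :: "'y::locally_convex_space set"
  assumes K: "closed K" "K \<noteq> {}" "cone K" "K + K \<subseteq> K"
    and A: "seq_compactin (sigma_topology K) A"
    and H: "countably_compactin (sigma_topology K) H"
    and c: "c \<longlonglongrightarrow> c0"
    and y: "\<And>n. y \<in> A + scaleR (c n) ` H + K"
  shows "y \<in> A + scaleR c0 ` H + K"
proof -
  have "\<exists>z\<in>A. \<exists>h\<in>H. y - z - c n *\<^sub>R h \<in> K" for n
  proof -
    obtain z h k where zhk: "z \<in> A" "h \<in> H" "k \<in> K" "y = z + c n *\<^sub>R h + k"
      using y[of n] by (auto simp: set_plus_def)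
    then have "y - z - c n *\<^sub>R h = k"
      by simp
    then show ?thesis
      using zhk by blast
  qed
  then obtain z h where zh: "\<And>n. z n \<in> A" "\<And>n. h n \<in> H" "\<And>n. y - z n - c n *\<^sub>R h n \<in> K"
    by metis
  obtain z0 r where r: "z0 \<in> A" "strict_mono r" "limitin (sigma_topology K) (z \<circ> r) z0 sequentially"
    using A zh(1) unfolding seq_compactin_def by blast
  have "\<forall>n. (h \<circ> r) n \<in> H"
    using zh(2) by simp
  then obtain h0 where h0: "h0 \<in> H" "cluster_pointin (sigma_topology K) (h \<circ> r) h0"
    using H unfolding countably_compactin_def by blast
  have cr: "(\<lambda>n. c (r n)) \<longlonglongrightarrow> c0"
    using LIMSEQ_subseq_LIMSEQ[OF c r(2)] by (simp add: o_def)
  have "y - z0 - c0 *\<^sub>R h0 \<in> K"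
  proof (rule mem_closed_cone_if_dual_cone_nonneg[OF K])
    fix \<phi> assume \<phi>: "\<phi> \<in> dual_cone K"
    note lin = linear_diff[OF linear_dual_cone[OF \<phi>]] linear_cmul[OF linear_dual_cone[OF \<phi>]]
    let ?g = "\<lambda>n. \<phi> y - \<phi> (z (r n))"
    have g: "?g \<longlonglongrightarrow> \<phi> y - \<phi> z0"
      using tendsto_dual_cone_if_limitin_sigma[OF r(3) \<phi>] by (intro tendsto_intros) (simp add: o_def)
    have le: "0 \<le> ?g n - c (r n) * \<phi> (h (r n))" for n
    proof -
      have "0 \<le> \<phi> (y - z (r n) - c (r n) *\<^sub>R h (r n))"
        using zh(3)[of "r n"] \<phi> by (simp add: dual_cone_def)
      then show ?thesis
        by (simp add: lin)
    qed
    \<comment> \<open>An index is chosen at which \<open>\<phi> (h n)\<close> is close to \<open>\<phi> h0\<close>, which happens frequently, and the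
      remaining terms are close to their limits, which happens eventually.\<close>
    have bound: "\<phi> y - \<phi> z0 - c0 * \<phi> h0 \<ge> - e * (\<bar>c0\<bar> + 2)" if "e > 0" for e
    proof -
      have "(\<lambda>n. ?g n - c (r n) * \<phi> h0) \<longlonglongrightarrow> \<phi> y - \<phi> z0 - c0 * \<phi> h0"
        by (intro tendsto_intros g cr)
      then have "\<forall>\<^sub>F n in sequentially. ?g n - c (r n) * \<phi> h0 < \<phi> y - \<phi> z0 - c0 * \<phi> h0 + e"
        using that by (intro order_tendstoD) auto
      moreover have "\<forall>\<^sub>F n in sequentially. \<bar>c (r n)\<bar> < \<bar>c0\<bar> + 1"
        using order_tendstoD(2)[OF tendsto_rabs[OF cr], of "\<bar>c0\<bar> + 1"] by simp
      ultimately have "\<forall>\<^sub>F n in sequentially. ?g n - c (r n) * \<phi> h0 < \<phi> y - \<phi> z0 - c0 * \<phi> h0 + e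
          \<and> \<bar>c (r n)\<bar> < \<bar>c0\<bar> + 1"
        by (rule eventually_conj)
      then have "\<exists>\<^sub>F n in sequentially. \<bar>\<phi> ((h \<circ> r) n) - \<phi> h0\<bar> < e \<and>
          (?g n - c (r n) * \<phi> h0 < \<phi> y - \<phi> z0 - c0 * \<phi> h0 + e \<and> \<bar>c (r n)\<bar> < \<bar>c0\<bar> + 1)"
        using frequently_dual_cone_if_cluster_pointin_sigma[OF h0(2) \<phi> that]
        by (simp add: frequently_eventually_frequently)
      then obtain n where n: "\<bar>\<phi> (h (r n)) - \<phi> h0\<bar> < e"
          "?g n - c (r n) * \<phi> h0 < \<phi> y - \<phi> z0 - c0 * \<phi> h0 + e" "\<bar>c (r n)\<bar> < \<bar>c0\<bar> + 1"
        by (auto dest: frequently_ex)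
      have "c (r n) * (\<phi> h0 - \<phi> (h (r n))) \<le> \<bar>c (r n)\<bar> * \<bar>\<phi> (h (r n)) - \<phi> h0\<bar>"
        by (metis abs_ge_self abs_minus_commute abs_mult)
      also have "\<dots> \<le> (\<bar>c0\<bar> + 1) * e"
        using n by (intro mult_mono) auto
      finally show ?thesis
        using n(2) le[of n] by (simp add: algebra_simps)
    qed
    have "0 \<le> \<phi> y - \<phi> z0 - c0 * \<phi> h0 + d" if "d > 0" for d
    proof -
      have "0 < d / (\<bar>c0\<bar> + 2)" using that by (intro divide_pos_pos) auto
      moreover have "- (d / (\<bar>c0\<bar> + 2)) * (\<bar>c0\<bar> + 2) = - d"
        by (simp add: field_simps)
      ultimately show ?thesis using bound[of "d / (\<bar>c0\<bar> + 2)"] by linarith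
    qed
    then have "0 \<le> \<phi> y - \<phi> z0 - c0 * \<phi> h0"
      by (rule field_le_epsilon)
    then show "0 \<le> \<phi> (y - z0 - c0 *\<^sub>R h0)"
      by (simp add: lin)
  qed
  moreover have "y = z0 + c0 *\<^sub>R h0 + (y - z0 - c0 *\<^sub>R h0)"
    by simp
  ultimately show ?thesis
    using r(1) h0(1) unfolding set_plus_def by blast
qed

section \<open>Adding scaled copies of a set whose sum with a cone is convex\<close>

text \<open>The surplus \<open>(b - a)h\<close> is absorbed by the cone.\<close>

lemma scaled_plus_cone_antimono:
  fixes H K :: "'y::real_vector set"
  assumes K: "cone K" "K + K \<subseteq> K" and H: "H \<subseteq> K" and "a \<le> b"
  shows "scaleR b ` H + K \<subseteq> scaleR a ` H + K"
proof
  fix y assume "y \<in> scaleR b ` H + K"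
  then obtain h k where hk: "h \<in> H" "k \<in> K" "y = b *\<^sub>R h + k"
    by (auto simp: set_plus_def)
  have "(b - a) *\<^sub>R h \<in> K"
    using hk H K(1) assms(4) by (auto simp: cone_def)
  then have "(b - a) *\<^sub>R h + k \<in> K"
    using K(2) hk(2) by (auto simp: set_plus_def)
  moreover have "y = a *\<^sub>R h + ((b - a) *\<^sub>R h + k)"
    using hk(3) by (simp add: algebra_simps)
  ultimately show "y \<in> scaleR a ` H + K"
    using hk(1) unfolding set_plus_def by blast
qed

text \<open>
  A convex combination of two points of \<open>H\<close> is a point of \<open>H\<close> up to an element of the cone; this
  is scaled by \<open>a + b\<close>.
\<close>

lemma scaled_plus_scaled_plus_cone:
  fixes H K :: "'y::real_vector set"
  assumes K: "K \<noteq> {}" "cone K" "K + K \<subseteq> K" and H: "convex (H + K)"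
    and ab: "a \<ge> 0" "b \<ge> 0"
  shows "scaleR a ` H + scaleR b ` H + K \<subseteq> scaleR (a + b) ` H + K"
proof
  fix y assume "y \<in> scaleR a ` H + scaleR b ` H + K"
  then obtain g h k where ghk: "g \<in> H" "h \<in> H" "k \<in> K" "y = a *\<^sub>R g + b *\<^sub>R h + k"
    by (auto simp: set_plus_def)
  show "y \<in> scaleR (a + b) ` H + K"
  proof (cases "a + b = 0")
    case True
    then have "a = 0" "b = 0" using ab by auto
    then have "y = (a + b) *\<^sub>R g + k" using ghk by simp
    then show ?thesis using ghk by (auto simp: set_plus_def)
  next
    case False
    have "0 \<in> K" using K by (intro zero_mem_cone)
    then have "g + 0 \<in> H + K" "h + 0 \<in> H + K"
      using ghk unfolding set_plus_def by blast+
    then have "(a / (a + b)) *\<^sub>R g + (b / (a + b)) *\<^sub>R h \<in> H + K"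
      using ab False by (intro convexD[OF H]) (auto simp: add_divide_distrib[symmetric])
    then obtain i l where il: "i \<in> H" "l \<in> K"
        "(a / (a + b)) *\<^sub>R g + (b / (a + b)) *\<^sub>R h = i + l"
      by (auto simp: set_plus_def)
    have "(a + b) *\<^sub>R (i + l) = a *\<^sub>R g + b *\<^sub>R h"
      using False unfolding il(3)[symmetric] by (simp add: scaleR_add_right)
    then have "y = (a + b) *\<^sub>R i + ((a + b) *\<^sub>R l + k)"
      using ghk(4) by (simp add: scaleR_add_right add.assoc)
    moreover have "(a + b) *\<^sub>R l + k \<in> K"
    proof -
      have "(a + b) *\<^sub>R l \<in> K"
        using K(2) il(2) ab by (simp add: cone_def)
      then show ?thesis
        using K(3) ghk(3) set_plus_intro by blast
    qed
    ultimately show ?thesis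
      using il(1) unfolding set_plus_def by blast
  qed
qed

lemma scaled_subset_trans:
  fixes A B C H K :: "'y::real_vector set"
  assumes K: "K \<noteq> {}" "cone K" "K + K \<subseteq> K" and H: "H \<subseteq> K" "convex (H + K)"
    and ab: "a \<ge> 0" "b \<ge> 0" "c \<le> a + b"
    and AB: "A \<subseteq> B + scaleR a ` H + K" and BC: "B \<subseteq> C + scaleR b ` H + K"
  shows "A \<subseteq> C + scaleR c ` H + K"
proof -
  have "A \<subseteq> C + scaleR b ` H + K + scaleR a ` H + K"
    using AB BC by (meson order_refl order_trans set_plus_mono2)
  also have "\<dots> = C + (scaleR a ` H + scaleR b ` H + (K + K))"
    by (simp add: add_ac)
  also have "\<dots> \<subseteq> C + (scaleR a ` H + scaleR b ` H + K)"
    by (intro set_plus_mono2 order_refl K(3))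
  also have "\<dots> \<subseteq> C + (scaleR (a + b) ` H + K)"
    by (intro set_plus_mono2 order_refl scaled_plus_scaled_plus_cone K H ab)
  also have "\<dots> \<subseteq> C + (scaleR c ` H + K)"
    by (intro set_plus_mono2 order_refl scaled_plus_cone_antimono K H ab)
  finally show ?thesis
    by (simp add: add.assoc)
qed

section \<open>A maximality principle in metric spaces\<close>

text \<open>
  From each point one steps to a successor at least half as far away as any other successor could
  be. Distances are truncated at \<open>1\<close> so that the supremum exists without a boundedness assumption.
  Along a convergent chain the steps tend to \<open>0\<close>. Everything above the limit is above each point
  of the chain, so its truncated distance to that point is at most twice the next step; in the limit
  the distance is \<open>0\<close>.
\<close>

lemma exists_maximal_if_chains_converge:
  fixes S :: "'x::metric_space set" and R :: "'x \<Rightarrow> 'x \<Rightarrow> bool"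
  assumes x0: "x0 \<in> S"
    and refl: "\<And>x. x \<in> S \<Longrightarrow> R x x"
    and trans: "\<And>x y z. R x y \<Longrightarrow> R y z \<Longrightarrow> R x z"
    and chains: "\<And>xs :: nat \<Rightarrow> 'x. xs 0 = x0 \<Longrightarrow> (\<And>n. xs n \<in> S) \<Longrightarrow> (\<And>n. R (xs n) (xs (Suc n)))
      \<Longrightarrow> \<exists>x\<in>S. xs \<longlonglongrightarrow> x \<and> (\<forall>n. R (xs n) x)"
  shows "\<exists>x\<in>S. R x0 x \<and> (\<forall>z\<in>S. R x z \<longrightarrow> z = x)"
proof -
  have "\<exists>y. y \<in> S \<and> R x y \<and> (\<forall>z\<in>S. R x z \<longrightarrow> min 1 (dist x z) \<le> 2 * dist x y)"
    if "x \<in> S" for x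
  proof -
    let ?D = "(\<lambda>z. min 1 (dist x z)) ` {z\<in>S. R x z}"
    have bdd: "bdd_above ?D"
      by (rule bdd_aboveI2[of _ _ 1]) auto
    have x: "x \<in> {z\<in>S. R x z}"
      using that refl by simp
    have up: "min 1 (dist x z) \<le> Sup ?D" if "z \<in> S" "R x z" for z
      using that by (intro cSup_upper bdd) auto
    show ?thesis
    proof (cases "Sup ?D \<le> 0")
      case True
      then show ?thesis
        using x order_trans[OF up] by (intro exI[of _ x]) simp
    next
      case False
      then have "Sup ?D / 2 < Sup ?D" by simp
      then obtain y where y: "y \<in> S" "R x y" "Sup ?D / 2 < min 1 (dist x y)"
        using less_cSup_iff[OF _ bdd, of "Sup ?D / 2"] x by blast
      then show ?thesis
        using up by (intro exI[of _ y]) force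
    qed
  qed
  then obtain g where g: "\<And>x. x \<in> S \<Longrightarrow> g x \<in> S" "\<And>x. x \<in> S \<Longrightarrow> R x (g x)"
      "\<And>x z. x \<in> S \<Longrightarrow> z \<in> S \<Longrightarrow> R x z \<Longrightarrow> min 1 (dist x z) \<le> 2 * dist x (g x)"
    by metis
  define xs where "xs n = (g ^^ n) x0" for n
  have Suc: "xs (Suc n) = g (xs n)" for n
    by (simp add: xs_def)
  have S: "xs n \<in> S" for n
    by (induction n) (use x0 g(1) in \<open>auto simp: xs_def\<close>)
  have R: "R (xs n) (xs (Suc n))" for n
    using g(2)[OF S] Suc by simp
  obtain x where x: "x \<in> S" "xs \<longlonglongrightarrow> x" "\<And>n. R (xs n) x"
    using chains[of xs, OF _ S R] by (auto simp: xs_def)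
  have "z = x" if z: "z \<in> S" "R x z" for z
  proof -
    have "(\<lambda>n. 2 * dist (xs n) (xs (Suc n))) \<longlonglongrightarrow> 2 * dist x x"
      by (intro tendsto_intros x(2) LIMSEQ_Suc[OF x(2)])
    moreover have "(\<lambda>n. min 1 (dist (xs n) z)) \<longlonglongrightarrow> min 1 (dist x z)"
      by (intro tendsto_intros x(2))
    moreover have "min 1 (dist (xs n) z) \<le> 2 * dist (xs n) (xs (Suc n))" for n
      using g(3)[OF S z(1) trans[OF x(3) z(2)]] Suc by simp
    ultimately have "min 1 (dist x z) \<le> 2 * dist x x"
      by (meson LIMSEQ_le)
    then show ?thesis by (simp add: min_def split: if_splits)
  qed
  then show ?thesis
    using x x(3)[of 0] by (auto simp: xs_def)
qed

lemma Cauchy_if_sum_dist_bounded: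
  fixes xs :: "nat \<Rightarrow> 'x::metric_space"
  assumes "\<And>n. (\<Sum>i<n. dist (xs i) (xs (Suc i))) \<le> B"
  shows "Cauchy xs"
  unfolding Cauchy_altdef
proof (intro allI impI)
  let ?s = "\<lambda>n. \<Sum>i<n. dist (xs i) (xs (Suc i))"
  fix e :: real assume "e > 0"
  have "summable (\<lambda>i. dist (xs i) (xs (Suc i)))"
    by (rule summableI_nonneg_bounded[of _ B]) (use assms in auto)
  then have "Cauchy ?s"
    by (simp add: summable_iff_convergent convergent_Cauchy)
  then obtain M where M: "\<And>m n. m \<ge> M \<Longrightarrow> n > m \<Longrightarrow> dist (?s m) (?s n) < e"
    unfolding Cauchy_altdef using \<open>e > 0\<close> by metis
  have le: "dist (xs m) (xs (m + k)) \<le> ?s (m + k) - ?s m" for m k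
  proof (induction k)
    case (Suc k)
    then show ?case
      using dist_triangle[of "xs m" "xs (m + Suc k)" "xs (m + k)"] by simp
  qed simp
  have "dist (xs m) (xs n) < e" if "m \<ge> M" "n > m" for m n
    using M[OF that] le[of m "n - m"] that by (simp add: dist_real_def)
  then show "\<exists>M. \<forall>m\<ge>M. \<forall>n>m. dist (xs m) (xs n) < e"
    by blast
qed

section \<open>The variational principle\<close>

text \<open>
  If \<open>c \<ge> \<epsilon>\<close>, then \<open>f x\<^sub>0 \<subseteq> f x + \<epsilon>H + K\<close>, so the point of \<open>f x\<^sub>0\<close> that witnesses \<open>\<epsilon>\<close>-efficiency
  exceeds some value of \<open>f\<close> at \<open>x\<close> by an element of \<open>\<epsilon>H + K\<close>, which efficiency rules out.
\<close>

lemma approx_efficient_descent_less: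
  fixes f :: "'x \<Rightarrow> 'y::real_vector set"
  assumes K: "cone K" "K + K \<subseteq> K" and H: "H \<subseteq> K"
    and x0: "x0 \<in> approx_efficient f S K H \<epsilon>"
    and x: "x \<in> S" "f x0 \<subseteq> f x + scaleR c ` H + K"
  shows "c < \<epsilon>"
proof (rule ccontr)
  assume "\<not> c < \<epsilon>"
  then have "\<epsilon> \<le> c" by simp
  obtain y0 where y0: "y0 \<in> f x0"
      "(\<lambda>y. y - y0) ` (\<Union>x\<in>S. f x) \<inter> (scaleR (- \<epsilon>) ` H + uminus ` K) = {}"
    using x0 by (auto simp: approx_efficient_def)
  have "y0 \<in> f x + (scaleR c ` H + K)"
    using y0(1) x(2) by (auto simp: add.assoc)
  then have "y0 \<in> f x + (scaleR \<epsilon> ` H + K)"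
    using scaled_plus_cone_antimono[OF K H \<open>\<epsilon> \<le> c\<close>] set_plus_mono2[OF order_refl] by blast
  then obtain y h k where yhk: "y \<in> f x" "h \<in> H" "k \<in> K" "y0 = y + (\<epsilon> *\<^sub>R h + k)"
    by (auto simp: set_plus_def)
  have "y - y0 = (- \<epsilon>) *\<^sub>R h + - k"
    using yhk(4) by (simp add: algebra_simps)
  then have "y - y0 \<in> scaleR (- \<epsilon>) ` H + uminus ` K"
    using yhk unfolding set_plus_def by blast
  then show False
    using y0(2) yhk(1) x(1) by blast
qed

theorem corollary6p9:
  fixes f :: "'x::metric_space \<Rightarrow> 'y::locally_convex_space set"
    and K H :: "'y set" and S :: "'x set" and x\<^sub>0 :: 'x and \<epsilon> \<gamma> :: real
  assumes K_cone: "K \<noteq> {}" "cone K" "K + K \<subseteq> K"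
    and K_nontrivial: "K \<noteq> {0}" "K \<noteq> UNIV"
    and K_pointed: "K \<inter> uminus ` K = {0}"
    and H: "H \<subseteq> K" "H \<noteq> {}" "convex (H + K)" "0 \<notin> vcl (H + K)"
    and S: "S \<noteq> {}" "closed S" "x\<^sub>0 \<in> S"
    and pos: "\<epsilon> > 0" "\<gamma> > 0"
    and i: "lower_complete f K \<or> complete (UNIV :: 'x set)"
    and ii: "x\<^sub>0 \<in> approx_efficient f S K H \<epsilon>"
    and iii: "seq_lower_monotone f K"
      "\<And>x. seq_compactin (sigma_topology K) (f x)"
      "countably_compactin (sigma_topology K) H"
      "closed K"
  shows "\<exists>xb\<in>S.
      f x\<^sub>0 \<subseteq> f xb + scaleR (\<gamma> * dist x\<^sub>0 xb) ` H + K \<and>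
      (\<forall>x\<in>S - {xb}. \<not> f xb \<subseteq> f x + scaleR (\<gamma> * dist xb x) ` H + K) \<and>
      dist x\<^sub>0 xb \<le> \<epsilon> / \<gamma>"
proof -
  define R where "R x z \<longleftrightarrow> f x \<subseteq> f z + scaleR (\<gamma> * dist x z) ` H + K" for x z
  have "0 \<in> K"
    using K_cone by (intro zero_mem_cone)
  have drop: "A \<subseteq> B + K" if "A \<subseteq> B + scaleR c ` H + K" "c \<ge> 0" for A B c
  proof -
    have "scaleR c ` H + K \<subseteq> scaleR 0 ` H + K"
      by (rule scaled_plus_cone_antimono[OF K_cone(2,3) H(1) that(2)])
    also have "scaleR 0 ` H + K = K"
      using H(2) by (auto simp: set_plus_def)
    finally have "B + (scaleR c ` H + K) \<subseteq> B + K"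
      by (intro set_plus_mono2) auto
    then show ?thesis
      using that(1) by (simp add: add.assoc)
  qed
  have self: "A \<subseteq> B + scaleR 0 ` H + K" if "A \<subseteq> B + K" for A B
    using that H(2) by (force simp: set_plus_def)
  have refl_plus: "A \<subseteq> A + K" for A :: "'y set"
    using \<open>0 \<in> K\<close> by (force simp: set_plus_def)
  have refl: "R x x" for x
    unfolding R_def using self[OF refl_plus] by simp
  have trans: "R x z" if xyz: "R x y" "R y z" for x y z
    unfolding R_def
  proof (rule scaled_subset_trans[OF K_cone H(1,3) _ _ _ xyz[unfolded R_def]])
    show "\<gamma> * dist x z \<le> \<gamma> * dist x y + \<gamma> * dist y z"
      using mult_left_mono[OF dist_triangle[of x z y], of \<gamma>] pos(2) by (simp add: distrib_left)
  qed (use pos(2) in auto)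
  have "\<exists>x\<in>S. R x\<^sub>0 x \<and> (\<forall>z\<in>S. R x z \<longrightarrow> z = x)"
  proof (rule exists_maximal_if_chains_converge[where R = R, OF S(3) refl trans])
    fix xs :: "nat \<Rightarrow> 'x"
    assume xs: "xs 0 = x\<^sub>0" "\<And>n. xs n \<in> S" "\<And>n. R (xs n) (xs (Suc n))"
    have desc: "f (xs n) \<subseteq> f (xs (Suc n)) + K" for n
      using pos(2) by (intro drop[OF xs(3)[of n, unfolded R_def]]) simp
    have later: "R (xs n) (xs (n + m))" for n m
    proof (induction m)
      case (Suc m)
      then show ?case using trans[OF Suc xs(3)[of "n + m"]] by simp
    qed (simp add: refl)
    \<comment> \<open>Accumulating the steps keeps the whole length of the chain, where transitivity alone would
      keep only the distance between its ends.\<close>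
    have "f x\<^sub>0 \<subseteq> f (xs n) + scaleR (\<gamma> * (\<Sum>i<n. dist (xs i) (xs (Suc i)))) ` H + K" for n
    proof (induction n)
      case 0
      show ?case
        unfolding xs(1) lessThan_0 sum.empty mult_zero_right by (rule self[OF refl_plus])
    next
      case (Suc n)
      show ?case
        by (rule scaled_subset_trans[OF K_cone H(1,3) _ _ _ Suc xs(3)[unfolded R_def]])
          (use pos(2) in \<open>simp_all add: distrib_left sum_nonneg\<close>)
    qed
    then have "\<gamma> * (\<Sum>i<n. dist (xs i) (xs (Suc i))) < \<epsilon>" for n
      by (intro approx_efficient_descent_less[OF K_cone(2,3) H(1) ii xs(2)])
    then have "(\<Sum>i<n. dist (xs i) (xs (Suc i))) \<le> \<epsilon> / \<gamma>" for n
      using pos(2) by (simp add: field_simps less_imp_le)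
    then have "Cauchy xs"
      by (rule Cauchy_if_sum_dist_bounded)
    then obtain x where x: "xs \<longlonglongrightarrow> x"
      using i desc unfolding lower_complete_def complete_def by blast
    have "x \<in> S"
      using closed_sequentially[OF S(2) xs(2) x] .
    have lim: "f (xs n) \<subseteq> f x + K" for n
      using iii(1) x desc unfolding seq_lower_monotone_def by blast
    have "R (xs n) x" for n
      unfolding R_def
    proof
      fix y assume y: "y \<in> f (xs n)"
      show "y \<in> f x + scaleR (\<gamma> * dist (xs n) x) ` H + K"
      proof (rule mem_compact_plus_scaled_cone_limit[OF iii(4) K_cone iii(2,3)])
        show "(\<lambda>m. \<gamma> * dist (xs n) (xs (n + m))) \<longlonglongrightarrow> \<gamma> * dist (xs n) x"
          using LIMSEQ_ignore_initial_segment[OF x, of n]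
          by (intro tendsto_intros) (simp add: add.commute)
        fix m
        have "f (xs n) \<subseteq> f x + scaleR (\<gamma> * dist (xs n) (xs (n + m))) ` H + K"
          by (rule scaled_subset_trans[OF K_cone H(1,3) _ _ _ later[of n m, unfolded R_def] self[OF lim]])
            (use pos(2) in simp_all)
        then show "y \<in> f x + scaleR (\<gamma> * dist (xs n) (xs (n + m))) ` H + K"
          using y by blast
      qed
    qed
    then show "\<exists>x\<in>S. xs \<longlonglongrightarrow> x \<and> (\<forall>n. R (xs n) x)"
      using x \<open>x \<in> S\<close> by blast
  qed
  then obtain xb where xb: "xb \<in> S" "R x\<^sub>0 xb" "\<And>z. z \<in> S \<Longrightarrow> R xb z \<Longrightarrow> z = xb"
    by blast
  have "\<gamma> * dist x\<^sub>0 xb < \<epsilon>"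
    using xb(2) unfolding R_def
    by (rule approx_efficient_descent_less[OF K_cone(2,3) H(1) ii xb(1)])
  then have "dist x\<^sub>0 xb \<le> \<epsilon> / \<gamma>"
    using pos(2) by (simp add: field_simps)
  then show ?thesis
    using xb unfolding R_def by blast
qed

end
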